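(* Let $\lambda>0$ be a real number. On $(H_3,g_0)$ the matter collineations coincide with the Ricci collineations, and they are exactly the Killing vector fields of $(H_3,g_0)$.
   Context: The Heisenberg group $H_3$ is $\mathbb{R}^3$ with global coordinates $(x,y,z)$ and multiplication $(x,y,z)(\tilde x,\tilde y,\tilde z)=(x+\tilde x,y+\tilde y,z+\tilde z-x\tilde y)$. For $\lambda>0$, $g_0$ is the left-invariant Riemannian metric $g_0=\frac{1}{\lambda^2}dx^2+dy^2+(x\,dy+dz)^2$. With $R(X,Y)=[\nabla_X,\nabla_Y]-\nabla_{[X,Y]}$ the curvature tensor of the Levi-Civita connection, the Ricci tensor is $\varrho(X,Y)=\sum_k g(e_k,e_k)\,g(R(e_k,X)Y,e_k)$ for an orthonormal basis $\{e_k\}$, $\tau$ is the scalar curvature (the $g$-trace of $\varrho$), and $T=\varrho-\frac12\tau g$ is the energy-momentum tensor. A smooth vector field $X$ is Killing if $\mathcal{L}_Xg=0$, a Ricci collineation if $\mathcal{L}_X\varrho=0$, and a matter collineation if $\mathcal{L}_XT=0$. *)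

theory Defs
  imports "HOL-Analysis.Analysis"
begin

section \<open>Tensor calculus on three-space with its global coordinates\<close>

text \<open>
  The manifold is \<open>real ^ 3\<close> with global coordinates \<open>(x, y, z) = (p $ 1, p $ 2, p $ 3)\<close>, and every
  tangent space is identified with \<open>real ^ 3\<close> through the coordinate basis.
\<close>

type_synonym vfield = "real ^ 3 \<Rightarrow> real ^ 3"
type_synonym tensor02 = "real ^ 3 \<Rightarrow> real ^ 3 \<Rightarrow> real ^ 3 \<Rightarrow> real"

primrec Ck :: "nat \<Rightarrow> ('a::real_normed_vector \<Rightarrow> 'b::real_normed_vector) \<Rightarrow> bool" where
  "Ck 0 f \<longleftrightarrow> continuous_on UNIV f"
| "Ck (Suc k) f \<longleftrightarrow>
     f differentiable_on UNIV \<and> (\<forall>v. Ck k (\<lambda>p. frechet_derivative f (at p) v))"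

definition smooth :: "('a::real_normed_vector \<Rightarrow> 'b::real_normed_vector) \<Rightarrow> bool" where
  "smooth f \<longleftrightarrow> (\<forall>k. Ck k f)"

definition deriv_along :: "vfield \<Rightarrow> (real ^ 3 \<Rightarrow> 'b::real_normed_vector) \<Rightarrow> real ^ 3 \<Rightarrow> 'b" where
  "deriv_along X f p = frechet_derivative f (at p) (X p)"

definition partial :: "3 \<Rightarrow> (real ^ 3 \<Rightarrow> real) \<Rightarrow> real ^ 3 \<Rightarrow> real" where
  "partial i f p = frechet_derivative f (at p) (axis i 1)"

definition lie_bracket :: "vfield \<Rightarrow> vfield \<Rightarrow> vfield" where
  "lie_bracket X Y p = deriv_along X Y p - deriv_along Y X p"

definition lie_derivative :: "vfield \<Rightarrow> tensor02 \<Rightarrow> vfield \<Rightarrow> vfield \<Rightarrow> real ^ 3 \<Rightarrow> real" where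
  "lie_derivative X h Y Z p =
     deriv_along X (\<lambda>q. h q (Y q) (Z q)) p
       - h p (lie_bracket X Y p) (Z p) - h p (Y p) (lie_bracket X Z p)"

definition lie_derivative_vanishes :: "vfield \<Rightarrow> tensor02 \<Rightarrow> bool" where
  "lie_derivative_vanishes X h \<longleftrightarrow>
     (\<forall>Y Z. smooth Y \<longrightarrow> smooth Z \<longrightarrow> (\<forall>p. lie_derivative X h Y Z p = 0))"

definition gram :: "tensor02 \<Rightarrow> real ^ 3 \<Rightarrow> real ^ 3 ^ 3" where
  "gram g p = (\<chi> i j. g p (axis i 1) (axis j 1))"

definition christoffel :: "tensor02 \<Rightarrow> 3 \<Rightarrow> 3 \<Rightarrow> 3 \<Rightarrow> real ^ 3 \<Rightarrow> real" where
  "christoffel g k i j p =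
     (1/2) * (\<Sum>l\<in>UNIV. matrix_inv (gram g p) $ k $ l *
        (partial i (\<lambda>q. gram g q $ j $ l) p + partial j (\<lambda>q. gram g q $ i $ l) p
          - partial l (\<lambda>q. gram g q $ i $ j) p))"

text \<open>
  The Levi-Civita connection, given by its Christoffel symbols; the lemmas
  \<open>levi_civita_torsion_free\<close> and \<open>levi_civita_metric\<close> below are its characterizing properties.
\<close>

definition levi_civita :: "tensor02 \<Rightarrow> vfield \<Rightarrow> vfield \<Rightarrow> vfield" where
  "levi_civita g X Y p =
     deriv_along X Y p + (\<chi> k. \<Sum>i\<in>UNIV. \<Sum>j\<in>UNIV. christoffel g k i j p * X p $ i * Y p $ j)"

definition curvature :: "tensor02 \<Rightarrow> vfield \<Rightarrow> vfield \<Rightarrow> vfield \<Rightarrow> vfield" where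
  "curvature g X Y Z p =
     levi_civita g X (levi_civita g Y Z) p - levi_civita g Y (levi_civita g X Z) p
       - levi_civita g (lie_bracket X Y) Z p"

definition orthonormal_at :: "tensor02 \<Rightarrow> real ^ 3 \<Rightarrow> (3 \<Rightarrow> real ^ 3) \<Rightarrow> bool" where
  "orthonormal_at g p e \<longleftrightarrow>
     (\<forall>i j. i \<noteq> j \<longrightarrow> g p (e i) (e j) = 0) \<and> (\<forall>i. \<bar>g p (e i) (e i)\<bar> = 1)"

definition onb :: "tensor02 \<Rightarrow> real ^ 3 \<Rightarrow> 3 \<Rightarrow> real ^ 3" where
  "onb g p = (SOME e. orthonormal_at g p e)"

text \<open>
  The curvature is tensorial, so its value on tangent vectors is computed by extending them to
  vector fields with constant coordinates.
\<close>

definition ricci :: "tensor02 \<Rightarrow> tensor02" where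
  "ricci g p u v =
     (\<Sum>k\<in>UNIV. g p (onb g p k) (onb g p k) *
        g p (curvature g (\<lambda>_. onb g p k) (\<lambda>_. u) (\<lambda>_. v) p) (onb g p k))"

definition scalar_curvature :: "tensor02 \<Rightarrow> real ^ 3 \<Rightarrow> real" where
  "scalar_curvature g p =
     (\<Sum>k\<in>UNIV. g p (onb g p k) (onb g p k) * ricci g p (onb g p k) (onb g p k))"

definition energy_momentum :: "tensor02 \<Rightarrow> tensor02" where
  "energy_momentum g p u v = ricci g p u v - (1/2) * scalar_curvature g p * g p u v"

definition killing_field :: "tensor02 \<Rightarrow> vfield \<Rightarrow> bool" where
  "killing_field g X \<longleftrightarrow> smooth X \<and> lie_derivative_vanishes X g"

definition ricci_collineation :: "tensor02 \<Rightarrow> vfield \<Rightarrow> bool" where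
  "ricci_collineation g X \<longleftrightarrow> smooth X \<and> lie_derivative_vanishes X (ricci g)"

definition matter_collineation :: "tensor02 \<Rightarrow> vfield \<Rightarrow> bool" where
  "matter_collineation g X \<longleftrightarrow> smooth X \<and> lie_derivative_vanishes X (energy_momentum g)"

subsection \<open>Characterization of the connection\<close>

lemma christoffel_sym:
  assumes "\<And>p u v. g p u v = g p v u"
  shows "christoffel g k i j p = christoffel g k j i p"
proof -
  have "gram g q $ i $ j = gram g q $ j $ i" for q
    using assms by (simp add: gram_def)
  then show ?thesis
    unfolding christoffel_def by (simp add: add.commute)
qed

lemma levi_civita_torsion_free:
  assumes "\<And>p u v. g p u v = g p v u"
  shows "levi_civita g X Y p - levi_civita g Y X p = lie_bracket X Y p"
proof -
  have "(\<Sum>i\<in>UNIV. \<Sum>j\<in>UNIV. christoffel g k i j p * X p $ i * Y p $ j) =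
        (\<Sum>i\<in>UNIV. \<Sum>j\<in>UNIV. christoffel g k i j p * Y p $ i * X p $ j)" for k
    by (subst sum.swap) (simp add: christoffel_sym[OF assms, where k=k] mult.commute mult.left_commute)
  then show ?thesis
    by (simp add: levi_civita_def lie_bracket_def)
qed

lemma bilinear_gram:
  assumes "bilinear (g p)"
  shows "g p u v = (\<Sum>i\<in>UNIV. \<Sum>j\<in>UNIV. gram g p $ i $ j * u $ i * v $ j)"
proof -
  have "g p u v = g p (\<Sum>i\<in>UNIV. u $ i *\<^sub>R axis i 1) (\<Sum>j\<in>UNIV. v $ j *\<^sub>R axis j 1)"
    by (simp add: basis_expansion scalar_mult_eq_scaleR[symmetric])
  also have "\<dots> = (\<Sum>i\<in>UNIV. \<Sum>j\<in>UNIV. gram g p $ i $ j * u $ i * v $ j)"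
    by (simp add: bilinear_sum[OF assms] sum.cartesian_product bilinear_lmul[OF assms]
        bilinear_rmul[OF assms] gram_def mult_ac)
  finally show ?thesis .
qed

lemma christoffel_lower:
  assumes "invertible (gram g p)"
  shows "(\<Sum>k\<in>UNIV. gram g p $ m $ k * christoffel g k i j p) =
    (1/2) * (partial i (\<lambda>q. gram g q $ j $ m) p + partial j (\<lambda>q. gram g q $ i $ m) p
          - partial m (\<lambda>q. gram g q $ i $ j) p)"
proof -
  define w where "w = (\<chi> l. partial i (\<lambda>q. gram g q $ j $ l) p
    + partial j (\<lambda>q. gram g q $ i $ l) p - partial l (\<lambda>q. gram g q $ i $ j) p)"
  define y where "y = matrix_inv (gram g p) *v w"
  have c: "christoffel g k i j p = (1/2) * y $ k" for k
    by (simp add: christoffel_def w_def y_def matrix_vector_mult_def)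
  have "gram g p ** matrix_inv (gram g p) = mat 1"
    using someI_ex[OF assms[unfolded invertible_def]] unfolding matrix_inv_def by blast
  then have yw: "gram g p *v y = w"
    by (simp add: y_def matrix_vector_mul_assoc)
  have "(\<Sum>k\<in>UNIV. gram g p $ m $ k * christoffel g k i j p) = (1/2) * (gram g p *v y) $ m"
    by (simp add: c matrix_vector_mult_def sum_divide_distrib)
  then show ?thesis by (simp add: yw) (simp add: w_def)
qed

lemma sum_rotate:
  fixes F :: "3 \<Rightarrow> 3 \<Rightarrow> 3 \<Rightarrow> real"
  shows "(\<Sum>k\<in>UNIV. \<Sum>i\<in>UNIV. \<Sum>j\<in>UNIV. F k i j) =
    (\<Sum>i\<in>UNIV. \<Sum>j\<in>UNIV. \<Sum>k\<in>UNIV. F k i j)"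
proof -
  have "(\<Sum>k\<in>UNIV. \<Sum>j\<in>UNIV. F k i j) = (\<Sum>j\<in>UNIV. \<Sum>k\<in>UNIV. F k i j)" for i
    by (rule sum.swap)
  then show ?thesis by (subst sum.swap) simp
qed

lemma levi_civita_metric:
  assumes sym: "\<And>p u v. g p u v = g p v u"
    and bil: "\<And>p. bilinear (g p)"
    and inv: "invertible (gram g p)"
    and dg: "\<And>i j. (\<lambda>q. gram g q $ i $ j) differentiable (at p)"
    and dY: "Y differentiable (at p)" and dZ: "Z differentiable (at p)"
  shows "deriv_along X (\<lambda>q. g q (Y q) (Z q)) p =
    g p (levi_civita g X Y p) (Z p) + g p (Y p) (levi_civita g X Z p)"
proof -
  define G where "G i j = (\<lambda>q. gram g q $ i $ j)" for i j
  define DG where "DG i j = frechet_derivative (G i j) (at p)" for i j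
  define DY where "DY = frechet_derivative Y (at p)"
  define DZ where "DZ = frechet_derivative Z (at p)"
  have hG: "(G i j has_derivative DG i j) (at p)" for i j
    using dg unfolding DG_def G_def by (simp add: frechet_derivative_works[symmetric])
  have hY: "(Y has_derivative DY) (at p)" and hZ: "(Z has_derivative DZ) (at p)"
    using dY dZ unfolding DY_def DZ_def by (simp_all add: frechet_derivative_works[symmetric])
  have hY': "((\<lambda>q. Y q $ i) has_derivative (\<lambda>v. DY v $ i)) (at p)"
    and hZ': "((\<lambda>q. Z q $ i) has_derivative (\<lambda>v. DZ v $ i)) (at p)" for i
    using bounded_linear.has_derivative[OF bounded_linear_vec_nth hY]
      bounded_linear.has_derivative[OF bounded_linear_vec_nth hZ] by auto
  have ge: "g q u v = (\<Sum>i\<in>UNIV. \<Sum>j\<in>UNIV. G i j q * u $ i * v $ j)" for q u v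
    unfolding G_def by (rule bilinear_gram[OF bil])
  have "((\<lambda>q. \<Sum>i\<in>UNIV. \<Sum>j\<in>UNIV. G i j q * Y q $ i * Z q $ j) has_derivative
     (\<lambda>v. \<Sum>i\<in>UNIV. \<Sum>j\<in>UNIV. G i j p * Y p $ i * DZ v $ j +
        (G i j p * DY v $ i + DG i j v * Y p $ i) * Z p $ j)) (at p)"
    by (intro has_derivative_sum has_derivative_mult hG hY' hZ')
  note D = frechet_derivative_at[OF this, symmetric]
  have lhs: "deriv_along X (\<lambda>q. g q (Y q) (Z q)) p =
     (\<Sum>i\<in>UNIV. \<Sum>j\<in>UNIV. G i j p * Y p $ i * DZ (X p) $ j +
        (G i j p * DY (X p) $ i + DG i j (X p) * Y p $ i) * Z p $ j)"
    unfolding deriv_along_def ge D ..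
  have Gs: "G i j = G j i" for i j
    unfolding G_def gram_def by (simp add: sym)
  have low: "(\<Sum>k\<in>UNIV. G m k p * christoffel g k i j p) =
      (1/2) * (DG j m (axis i 1) + DG i m (axis j 1) - DG i j (axis m 1))" for m i j
    using christoffel_lower[OF inv, of m i j] unfolding G_def DG_def partial_def .
  have DGX: "DG i j (X p) = (\<Sum>a\<in>UNIV. X p $ a * DG i j (axis a 1))" for i j
  proof -
    have l: "linear (DG i j)" using hG has_derivative_linear by blast
    have "DG i j (X p) = DG i j (\<Sum>a\<in>UNIV. X p $ a *\<^sub>R axis a 1)"
      by (simp add: basis_expansion scalar_mult_eq_scaleR[symmetric])
    then show ?thesis by (simp add: linear_sum[OF l] linear_cmul[OF l])
  qed
  define C where "C = (\<lambda>W::real^3. \<chi> k. \<Sum>i\<in>UNIV. \<Sum>j\<in>UNIV. christoffel g k i j p * X p $ i * W $ j)"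
  have lc: "levi_civita g X Y p = DY (X p) + C (Y p)" "levi_civita g X Z p = DZ (X p) + C (Z p)"
    by (simp_all add: levi_civita_def deriv_along_def DY_def DZ_def C_def)
  have gC: "g p (V) (C W) = (\<Sum>m\<in>UNIV. \<Sum>i\<in>UNIV. \<Sum>j\<in>UNIV. V $ m * X p $ i * W $ j *
      ((1/2) * (DG j m (axis i 1) + DG i m (axis j 1) - DG i j (axis m 1))))" for V W
  proof -
    have "g p V (C W) = (\<Sum>m\<in>UNIV. \<Sum>k\<in>UNIV. \<Sum>i\<in>UNIV. \<Sum>j\<in>UNIV.
        V $ m * X p $ i * W $ j * (G m k p * christoffel g k i j p))"
      by (simp add: ge C_def sum_distrib_left mult_ac)
    also have "\<dots> = (\<Sum>m\<in>UNIV. \<Sum>i\<in>UNIV. \<Sum>j\<in>UNIV. \<Sum>k\<in>UNIV.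
        V $ m * X p $ i * W $ j * (G m k p * christoffel g k i j p))"
      by (rule sum.cong[OF refl]) (rule sum_rotate)
    finally show ?thesis by (simp only: sum_distrib_left[symmetric] low)
  qed
  have key: "g p (Y p) (C (Z p)) + g p (Z p) (C (Y p)) =
      (\<Sum>i\<in>UNIV. \<Sum>j\<in>UNIV. DG i j (X p) * Y p $ i * Z p $ j)"
  proof -
    let ?t = "\<lambda>m i j. (1/2) * (DG j m (axis i 1) + DG i m (axis j 1) - DG i j (axis m 1))"
    have DGs: "DG i j = DG j i" for i j
      unfolding DG_def by (simp only: Gs[of i j])
    have "(\<Sum>m\<in>UNIV. \<Sum>i\<in>UNIV. \<Sum>j\<in>UNIV. Z p $ m * X p $ i * Y p $ j * ?t m i j) =
        (\<Sum>m\<in>UNIV. \<Sum>j\<in>UNIV. \<Sum>i\<in>UNIV. Z p $ m * X p $ i * Y p $ j * ?t m i j)"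
      by (rule sum.cong[OF refl]) (rule sum.swap)
    also have "\<dots> = (\<Sum>j\<in>UNIV. \<Sum>m\<in>UNIV. \<Sum>i\<in>UNIV. Z p $ m * X p $ i * Y p $ j * ?t m i j)"
      by (rule sum.swap)
    finally have 1: "g p (Z p) (C (Y p)) =
        (\<Sum>m\<in>UNIV. \<Sum>j\<in>UNIV. \<Sum>i\<in>UNIV. Z p $ j * X p $ i * Y p $ m * ?t j i m)"
      unfolding gC .
    have 2: "g p (Y p) (C (Z p)) =
        (\<Sum>m\<in>UNIV. \<Sum>j\<in>UNIV. \<Sum>i\<in>UNIV. Y p $ m * X p $ i * Z p $ j * ?t m i j)"
      unfolding gC by (rule sum.cong[OF refl]) (rule sum.swap)
    have 3: "Y p $ m * X p $ i * Z p $ j * ?t m i j + Z p $ j * X p $ i * Y p $ m * ?t j i m =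
        X p $ i * DG m j (axis i 1) * Y p $ m * Z p $ j" for m i j
      using DGs[of j m] by (simp add: field_simps)
    show ?thesis
      unfolding 1 2 DGX sum.distrib[symmetric] 3 by (simp add: sum_distrib_right)
  qed
  have "g p (levi_civita g X Y p) (Z p) + g p (Y p) (levi_civita g X Z p) =
     g p (DY (X p)) (Z p) + g p (Y p) (DZ (X p)) +
       (g p (Y p) (C (Z p)) + g p (Z p) (C (Y p)))"
    by (simp add: lc bilinear_ladd[OF bil] bilinear_radd[OF bil] sym[of p "C (Y p)"])
  then show ?thesis
    unfolding key lhs by (simp add: ge sum.distrib algebra_simps)
qed

section \<open>The Heisenberg group\<close>

definition heis_mult :: "real ^ 3 \<Rightarrow> real ^ 3 \<Rightarrow> real ^ 3" where
  "heis_mult p q = vector [p $ 1 + q $ 1, p $ 2 + q $ 2, p $ 3 + q $ 3 - p $ 1 * q $ 2]"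

definition heis_metric :: "real \<Rightarrow> tensor02" where
  "heis_metric lam p u v =
     (1 / lam\<^sup>2) * u $ 1 * v $ 1 + u $ 2 * v $ 2
       + (p $ 1 * u $ 2 + u $ 3) * (p $ 1 * v $ 2 + v $ 3)"

lemma heis_metric_left_invariant:
  "heis_metric lam (heis_mult h p)
     (frechet_derivative (heis_mult h) (at p) u) (frechet_derivative (heis_mult h) (at p) v) =
   heis_metric lam p u v"
proof -
  have "heis_mult h = (\<lambda>q. h + (vector [q $ 1, q $ 2, q $ 3 - h $ 1 * q $ 2] :: real ^ 3))"
    by (auto simp: heis_mult_def fun_eq_iff vec_eq_iff forall_3)
  moreover have "linear (\<lambda>q::real^3. vector [q $ 1, q $ 2, q $ 3 - h $ 1 * q $ 2] :: real ^ 3)"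
    by (rule linearI) (auto simp: vec_eq_iff forall_3 algebra_simps)
  ultimately have "(heis_mult h has_derivative
      (\<lambda>q. vector [q $ 1, q $ 2, q $ 3 - h $ 1 * q $ 2])) (at p)"
    using has_derivative_add[OF has_derivative_const
        bounded_linear_imp_has_derivative[OF linear_conv_bounded_linear[THEN iffD1]], of _ h "at p"]
    by simp
  then have "frechet_derivative (heis_mult h) (at p) =
      (\<lambda>q. vector [q $ 1, q $ 2, q $ 3 - h $ 1 * q $ 2])"
    by (rule frechet_derivative_at[symmetric])
  then show ?thesis
    by (simp add: heis_metric_def heis_mult_def algebra_simps)
qed

lemma heis_metric_sym: "heis_metric lam p u v = heis_metric lam p v u"
  by (simp add: heis_metric_def mult_ac)

lemma heis_metric_bilinear: "bilinear (heis_metric lam p)"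
  unfolding bilinear_def
  by (auto intro!: linearI simp: heis_metric_def algebra_simps add_divide_distrib)

lemma heis_metric_pos_def:
  assumes "lam > 0" "u \<noteq> 0"
  shows "heis_metric lam p u u > 0"
proof -
  have pos: "a\<^sup>2 + b\<^sup>2 + c\<^sup>2 > 0" if "a \<noteq> 0 \<or> b \<noteq> 0 \<or> c \<noteq> 0" for a b c :: real
    using that by (auto simp: add_pos_nonneg add_nonneg_pos)
  have "heis_metric lam p u u = (u $ 1 / lam)\<^sup>2 + (u $ 2)\<^sup>2 + (p $ 1 * u $ 2 + u $ 3)\<^sup>2"
    by (simp add: heis_metric_def power2_eq_square)
  moreover have "u $ 1 / lam \<noteq> 0 \<or> u $ 2 \<noteq> 0 \<or> p $ 1 * u $ 2 + u $ 3 \<noteq> 0"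
    using assms by (auto simp: vec_eq_iff forall_3)
  ultimately show ?thesis
    by (metis pos)
qed

lemma heis_metric_gram_invertible:
  assumes "lam > 0"
  shows "invertible (gram (heis_metric lam) p)"
proof -
  have "det (gram (heis_metric lam) p) = 1 / lam\<^sup>2"
    by (simp add: det_3 gram_def heis_metric_def axis_def power2_eq_square algebra_simps)
  then show ?thesis using assms by (simp add: invertible_det_nz)
qed

lemma heis_metric_gram_differentiable:
  "(\<lambda>q. gram (heis_metric lam) q $ i $ j) differentiable (at p)"
  unfolding gram_def heis_metric_def vec_lambda_beta
  by (intro derivative_intros differentiable_add differentiable_mult differentiable_const
      bounded_linear_imp_differentiable bounded_linear_vec_nth)

lemma heis_metric_levi_civita:
  assumes "lam > 0" "Y differentiable (at p)" "Z differentiable (at p)"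
  shows "levi_civita (heis_metric lam) X Y p - levi_civita (heis_metric lam) Y X p = lie_bracket X Y p"
    and "deriv_along X (\<lambda>q. heis_metric lam q (Y q) (Z q)) p =
      heis_metric lam p (levi_civita (heis_metric lam) X Y p) (Z p) +
      heis_metric lam p (Y p) (levi_civita (heis_metric lam) X Z p)"
  using assms
  by (blast intro: levi_civita_torsion_free levi_civita_metric heis_metric_sym heis_metric_bilinear
      heis_metric_gram_invertible heis_metric_gram_differentiable)+

lemma heis_metric_orthonormal_at:
  assumes "lam > 0"
  shows "orthonormal_at (heis_metric lam) p
    (\<lambda>k. if k = 1 then axis 3 1 else if k = 2 then axis 2 1 - p $ 1 *\<^sub>R axis 3 1 else lam *\<^sub>R axis 1 1)"
  unfolding orthonormal_at_def heis_metric_def forall_3 using assms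
  by (simp add: axis_def power2_eq_square)

lemma orthonormal_at_onb_heis_metric:
  "lam > 0 \<Longrightarrow> orthonormal_at (heis_metric lam) p (onb (heis_metric lam) p)"
  unfolding onb_def by (rule someI[of "orthonormal_at (heis_metric lam) p"], rule heis_metric_orthonormal_at)

end

(* Write theta = x dy + dz and let h(a,b) = a theta^2 + b (dx^2 / lam^2 + dy^2). The metric, its Ricci
   tensor and its energy-momentum tensor are h(1,1), h(lam^2/2, -lam^2/2) and h(3 lam^2/4, -lam^2/4).
   For nonzero a and b, the equation L_X h(a,b) = 0 forces the x- and y-components of X to be independent
   of z; the remaining equations then say that X preserves theta and dx^2 / lam^2 + dy^2 separately,
   a condition in which a and b no longer occur. *)

theory Submission
  imports Defs
begin

section \<open>Directional derivatives of smooth maps\<close>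

text \<open>The direction comes first so that \<open>dir_deriv v f\<close> is again a map on points
  and can itself be differentiated.\<close>

definition dir_deriv :: "'a::real_normed_vector \<Rightarrow> ('a \<Rightarrow> 'b::real_normed_vector) \<Rightarrow> 'a \<Rightarrow> 'b" where
  "dir_deriv v f p = frechet_derivative f (at p) v"

lemma smooth_imp_differentiable: "smooth f \<Longrightarrow> f differentiable (at p)"
  unfolding smooth_def by (drule spec[of _ "Suc 0"]) (simp add: differentiable_on_def)

lemma smooth_imp_isCont: "smooth f \<Longrightarrow> isCont f p"
  unfolding smooth_def by (drule spec[of _ 0]) (simp add: continuous_on_eq_continuous_at)

lemma smooth_dir_deriv: "smooth f \<Longrightarrow> smooth (dir_deriv v f)"
  unfolding smooth_def dir_deriv_def[abs_def]
proof
  fix k assume "\<forall>k. Ck k f"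
  then have "Ck (Suc k) f" by blast
  then show "Ck k (\<lambda>p. frechet_derivative f (at p) v)" by simp
qed

lemma has_derivative_dir_deriv:
  "f differentiable (at p) \<Longrightarrow> (f has_derivative (\<lambda>v. dir_deriv v f p)) (at p)"
  unfolding dir_deriv_def by (simp add: frechet_derivative_works[symmetric])

lemmas smooth_has_derivative = has_derivative_dir_deriv[OF smooth_imp_differentiable]

lemma dir_deriv_eqI: "(f has_derivative f') (at p) \<Longrightarrow> dir_deriv v f p = f' v"
  unfolding dir_deriv_def by (metis frechet_derivative_at)

lemma dir_deriv_zero: "(\<And>p. f p = 0) \<Longrightarrow> dir_deriv v f p = 0"
  by (rule dir_deriv_eqI[of f "\<lambda>_. 0"]) (metis (no_types) ext has_derivative_const)

text \<open>Lets an equation valid at every point be differentiated in any direction, once the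
  product rule has supplied the derivative of its left side.\<close>

lemma has_derivative_zeroD:
  assumes "(f has_derivative f') (at p)" "\<And>q. f q = 0"
  shows "f' v = 0"
  using dir_deriv_eqI[OF assms(1)] dir_deriv_zero[of f, OF assms(2)] by metis

lemma dir_deriv_nth:
  assumes "X differentiable (at p)"
  shows "dir_deriv v (\<lambda>q. X q $ i) p = dir_deriv v X p $ i"
  by (rule dir_deriv_eqI)
    (rule bounded_linear.has_derivative[OF bounded_linear_vec_nth has_derivative_dir_deriv[OF assms]])

lemma Ck_nth: "Ck k X \<Longrightarrow> Ck k (\<lambda>p. X p $ i)"
  for X :: "'a::real_normed_vector \<Rightarrow> 'b::real_normed_vector ^ 'n"
proof (induction k arbitrary: X)
  case 0
  then show ?case by (simp add: continuous_on_component)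
next
  case (Suc k)
  then have d: "X differentiable (at p)" for p
    by (simp add: differentiable_on_def)
  have "frechet_derivative (\<lambda>q. X q $ i) (at p) v = frechet_derivative X (at p) v $ i" for p v
    using dir_deriv_nth[OF d] by (simp add: dir_deriv_def)
  moreover have "(\<lambda>q. X q $ i) differentiable (at p)" for p
    using bounded_linear.has_derivative[OF bounded_linear_vec_nth has_derivative_dir_deriv[OF d]]
    by (rule differentiableI)
  ultimately show ?case
    using Suc by (simp add: differentiable_on_def)
qed

lemma smooth_nth: "smooth X \<Longrightarrow> smooth (\<lambda>p. X p $ i)"
  for X :: "'a::real_normed_vector \<Rightarrow> 'b::real_normed_vector ^ 'n"
  by (simp add: smooth_def Ck_nth)

lemma smooth_const: "smooth (\<lambda>_. c)"
proof -
  have "Ck k (\<lambda>_::'a. c::'b)" for k and c :: 'b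
    by (induction k arbitrary: c) auto
  then show ?thesis by (simp add: smooth_def)
qed

section \<open>Symmetry of mixed directional derivatives\<close>

text \<open>The mean value theorem is used twice: in direction \<open>v\<close> for the increment of
  \<open>f\<close> under the shift by \<open>h\<close> times \<open>w\<close>, then in direction
  \<open>w\<close> for \<open>dir_deriv v f\<close>.\<close>

lemma second_difference_mean_value:
  fixes f :: "'a::real_normed_vector \<Rightarrow> real"
  assumes f: "smooth f" and h: "0 < h"
  obtains s t where "0 < s" "s < h" "0 < t" "t < h"
    "f (p + h *\<^sub>R v + h *\<^sub>R w) - f (p + h *\<^sub>R v) - f (p + h *\<^sub>R w) + f p =
      h\<^sup>2 * dir_deriv w (dir_deriv v f) (p + s *\<^sub>R v + t *\<^sub>R w)"
proof -
  have along: "((\<lambda>t. F (q + t *\<^sub>R u)) has_real_derivative dir_deriv u F (q + t *\<^sub>R u)) (at t)"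
    if "smooth F" for F :: "'a \<Rightarrow> real" and q u t
  proof -
    have "((\<lambda>t. q + t *\<^sub>R u) has_derivative (\<lambda>t. t *\<^sub>R u)) (at t)"
      by (auto intro!: derivative_eq_intros)
    from has_derivative_compose[OF this smooth_has_derivative[OF that]]
    have d: "((\<lambda>t. F (q + t *\<^sub>R u)) has_derivative (\<lambda>s. dir_deriv (s *\<^sub>R u) F (q + t *\<^sub>R u))) (at t)" .
    have "linear (\<lambda>v. dir_deriv v F (q + t *\<^sub>R u))"
      using smooth_has_derivative[OF that] has_derivative_linear by blast
    from linear_cmul[OF this] have "(\<lambda>s. dir_deriv (s *\<^sub>R u) F (q + t *\<^sub>R u)) = (*) (dir_deriv u F (q + t *\<^sub>R u))"
      by (simp add: mult.commute fun_eq_iff)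
    with d show ?thesis
      by (simp add: has_field_derivative_def)
  qed
  define \<phi> where "\<phi> = (\<lambda>t. f (p + h *\<^sub>R w + t *\<^sub>R v) - f (p + t *\<^sub>R v))"
  have "(\<phi> has_real_derivative
      dir_deriv v f (p + h *\<^sub>R w + t *\<^sub>R v) - dir_deriv v f (p + t *\<^sub>R v)) (at t)" for t
    unfolding \<phi>_def by (intro DERIV_diff along f)
  from MVT2[OF h this] obtain s where s: "0 < s" "s < h"
    "\<phi> h - \<phi> 0 = h * (dir_deriv v f (p + h *\<^sub>R w + s *\<^sub>R v) - dir_deriv v f (p + s *\<^sub>R v))"
    by auto
  from MVT2[OF h along[OF smooth_dir_deriv[OF f], of v "p + s *\<^sub>R v" w]] obtain t where
    t: "0 < t" "t < h" "dir_deriv v f (p + s *\<^sub>R v + h *\<^sub>R w) - dir_deriv v f (p + s *\<^sub>R v) =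
      h * dir_deriv w (dir_deriv v f) (p + s *\<^sub>R v + t *\<^sub>R w)"
    by auto
  have "p + s *\<^sub>R v + h *\<^sub>R w = p + h *\<^sub>R w + s *\<^sub>R v" by simp
  with s(3) t(3) have "\<phi> h - \<phi> 0 = h\<^sup>2 * dir_deriv w (dir_deriv v f) (p + s *\<^sub>R v + t *\<^sub>R w)"
    by (simp add: power2_eq_square)
  moreover have "\<phi> h - \<phi> 0 =
      f (p + h *\<^sub>R v + h *\<^sub>R w) - f (p + h *\<^sub>R v) - f (p + h *\<^sub>R w) + f p"
    by (simp add: \<phi>_def algebra_simps)
  ultimately show ?thesis
    using that[of s t] s t by simp
qed

text \<open>The second difference is symmetric in \<open>v\<close> and \<open>w\<close>, so the two
  mixed derivatives agree at suitable pairs of points near \<open>p\<close>. As the step tends to 0,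
  both points tend to \<open>p\<close>, and continuity of the second derivatives gives equality
  there.\<close>

lemma dir_deriv_commute:
  fixes f :: "'a::real_normed_vector \<Rightarrow> real"
  assumes f: "smooth f"
  shows "dir_deriv w (dir_deriv v f) p = dir_deriv v (dir_deriv w f) p"
proof -
  define F where "F = dir_deriv w (dir_deriv v f)"
  define G where "G = dir_deriv v (dir_deriv w f)"
  define h where "h = (\<lambda>n. inverse (real (Suc n)))"
  have h0: "h n > 0" for n by (simp add: h_def)
  have "\<exists>s t s' t'. 0 < s \<and> s < h n \<and> 0 < t \<and> t < h n \<and> 0 < s' \<and> s' < h n \<and> 0 < t' \<and> t' < h n \<and>
      F (p + s *\<^sub>R v + t *\<^sub>R w) = G (p + s' *\<^sub>R w + t' *\<^sub>R v)" for n
  proof -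
    obtain s t where 1: "0 < s" "s < h n" "0 < t" "t < h n"
      "f (p + h n *\<^sub>R v + h n *\<^sub>R w) - f (p + h n *\<^sub>R v) - f (p + h n *\<^sub>R w) + f p =
        (h n)\<^sup>2 * F (p + s *\<^sub>R v + t *\<^sub>R w)"
      unfolding F_def using second_difference_mean_value[OF f h0] .
    obtain s' t' where 2: "0 < s'" "s' < h n" "0 < t'" "t' < h n"
      "f (p + h n *\<^sub>R w + h n *\<^sub>R v) - f (p + h n *\<^sub>R w) - f (p + h n *\<^sub>R v) + f p =
        (h n)\<^sup>2 * G (p + s' *\<^sub>R w + t' *\<^sub>R v)"
      unfolding G_def using second_difference_mean_value[OF f h0] .
    have "p + h n *\<^sub>R w + h n *\<^sub>R v = p + h n *\<^sub>R v + h n *\<^sub>R w" by simp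
    with 1(5) 2(5) have "(h n)\<^sup>2 * F (p + s *\<^sub>R v + t *\<^sub>R w) = (h n)\<^sup>2 * G (p + s' *\<^sub>R w + t' *\<^sub>R v)"
      by (simp add: algebra_simps)
    then have "F (p + s *\<^sub>R v + t *\<^sub>R w) = G (p + s' *\<^sub>R w + t' *\<^sub>R v)"
      using h0[of n] by simp
    with 1 2 show ?thesis by blast
  qed
  then obtain s t s' t' where
    st: "\<And>n. 0 < s n \<and> s n < h n" "\<And>n. 0 < t n \<and> t n < h n"
      "\<And>n. 0 < s' n \<and> s' n < h n" "\<And>n. 0 < t' n \<and> t' n < h n"
    and eq: "\<And>n. F (p + s n *\<^sub>R v + t n *\<^sub>R w) = G (p + s' n *\<^sub>R w + t' n *\<^sub>R v)"
    by metis
  have null: "r \<longlonglongrightarrow> 0" if "\<And>n. 0 < r n \<and> r n < h n" for r :: "nat \<Rightarrow> real"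
    by (rule tendsto_sandwich[OF _ _ tendsto_const LIMSEQ_inverse_real_of_nat])
      (use that in \<open>auto intro!: always_eventually less_imp_le simp: h_def\<close>)
  have pt: "(\<lambda>n. p + r n *\<^sub>R a + r' n *\<^sub>R b) \<longlonglongrightarrow> p" if "r \<longlonglongrightarrow> 0" "r' \<longlonglongrightarrow> 0" for r r' a b
    using tendsto_add[OF tendsto_add[OF tendsto_const tendsto_scaleR[OF that(1) tendsto_const]]
        tendsto_scaleR[OF that(2) tendsto_const], of p a b] by simp
  have "isCont F p" "isCont G p"
    unfolding F_def G_def by (intro smooth_imp_isCont smooth_dir_deriv f)+
  then have F: "(\<lambda>n. F (p + s n *\<^sub>R v + t n *\<^sub>R w)) \<longlonglongrightarrow> F p"
    and G: "(\<lambda>n. G (p + s' n *\<^sub>R w + t' n *\<^sub>R v)) \<longlonglongrightarrow> G p"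
    using isCont_tendsto_compose[OF _ pt[OF null[OF st(1)] null[OF st(2)]]]
      isCont_tendsto_compose[OF _ pt[OF null[OF st(3)] null[OF st(4)]]] by blast+
  from LIMSEQ_unique[OF F[unfolded eq] G] show ?thesis
    by (simp add: F_def G_def)
qed

section \<open>The collineation equations\<close>

lemma has_derivative_nth_1: "((\<lambda>p::real^3. p $ 1) has_derivative (\<lambda>w. w $ 1)) (at p)"
  by (rule bounded_linear_imp_has_derivative[OF bounded_linear_vec_nth])

text \<open>
  These are the collineation equations in the frame \<open>\<partial>\<^sub>z, \<partial>\<^sub>y - x \<partial>\<^sub>z, \<partial>\<^sub>x\<close> with \<open>c = 1 / lam\<^sup>2\<close>.
  Since \<open>\<partial>\<^sub>z\<close> is central, differentiating them in \<open>z\<close> gives a first-order system for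
  \<open>u = \<partial>\<^sub>z B\<close> and \<open>v = \<partial>\<^sub>z A\<close>; differentiating once more along the two other frame fields
  makes \<open>u\<close> constant along both, hence along their commutator \<open>\<plusminus>\<partial>\<^sub>z\<close>, and then \<open>u = v = 0\<close>.
\<close>

lemma heisenberg_collineation_pde:
  fixes A B C :: "real ^ 3 \<Rightarrow> real" and a b c :: real
  defines "d \<equiv> \<lambda>i. dir_deriv (axis i 1 :: real ^ 3)"
  assumes smooth: "smooth A" "smooth B" "smooth C" and nz: "a \<noteq> 0" "b \<noteq> 0" "c \<noteq> 0"
    and e11: "\<And>p. p $ 1 * d 3 B p + d 3 C p = 0"
    and e22: "\<And>p. d 2 B p - p $ 1 * d 3 B p = 0"
    and e33: "\<And>p. d 1 A p = 0"
    and e23: "\<And>p. d 1 B p + c * (d 2 A p - p $ 1 * d 3 A p) = 0"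
    and e12: "\<And>p. a * (A p + d 2 C p - p $ 1 * d 3 C p) + b * d 3 B p = 0"
    and e13: "\<And>p. a * (p $ 1 * d 1 B p + d 1 C p) + b * c * d 3 A p = 0"
  shows "d 3 A p = 0" and "d 3 B p = 0"
proof -
  define u where "u = d 3 B"
  define v where "v = d 3 A"
  have sm: "smooth (d i f)" if "smooth f" for i f
    using that by (simp add: d_def smooth_dir_deriv)
  have su: "smooth u" and sv: "smooth v"
    by (simp_all add: u_def v_def sm smooth)
  have D: "(f has_derivative (\<lambda>w. dir_deriv w f p)) (at p)" if "smooth f" for f :: "real ^ 3 \<Rightarrow> real" and p
    using that by (rule smooth_has_derivative)
  note Dx = has_derivative_nth_1
  have comm: "d i (d j f) p = d j (d i f) p" if "smooth f" for i j f p
    using dir_deriv_commute[OF that] by (simp add: d_def)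
  have ax: "axis i (1::real) $ (j::3) = (if i = j then 1 else 0)" for i j
    by (simp add: axis_def)
  have dfold: "dir_deriv (axis i 1) f = d i f" for i and f :: "real ^ 3 \<Rightarrow> real"
    by (simp add: d_def)
  have Bz: "d i (d 3 B) = d i u" and Az: "d i (d 3 A) = d i v" for i
    by (simp_all add: u_def v_def)
  have Cz: "d 3 C = (\<lambda>p. - (p $ 1 * u p))"
    using e11 by (simp add: u_def fun_eq_iff eq_neg_iff_add_eq_0 add.commute)
  \<comment> \<open>The second summand comes from differentiating the coefficient x and is present
    only for \<open>i = 1\<close>.\<close>
  have Czi: "d i (d 3 C) p = - (p $ 1 * d i u p + axis i 1 $ 1 * u p)" for i p
    unfolding Cz unfolding d_def
    by (rule dir_deriv_eqI) (intro has_derivative_minus has_derivative_mult D Dx su)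
  \<comment> \<open>The facts \<open>s1\<close> to \<open>s5\<close> are the z-derivatives of
    \<open>e33\<close>, \<open>e22\<close>, \<open>e23\<close>, \<open>e12\<close> and
    \<open>e13\<close>, with mixed derivatives exchanged and \<open>d 3 C\<close> eliminated by
    \<open>Cz\<close>. The coefficients do not depend on z, so only \<open>A\<close>,
    \<open>B\<close> and \<open>C\<close> get differentiated.\<close>
  have s1: "d 1 v p = 0" for p
    using dir_deriv_zero[of "d 1 A", OF e33, of "axis 3 1"] comm[OF smooth(1), of 3 1]
    by (simp add: d_def v_def)
  have s2: "d 2 u p - p $ 1 * d 3 u p = 0" for p
  proof -
    have "((\<lambda>p. d 2 B p - p $ 1 * d 3 B p) has_derivative
       (\<lambda>w. dir_deriv w (d 2 B) p - (p $ 1 * dir_deriv w (d 3 B) p + w $ 1 * d 3 B p))) (at p)"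
      by (intro has_derivative_diff has_derivative_mult D Dx sm smooth)
    from has_derivative_zeroD[OF this e22, of "axis 3 1"] show ?thesis
      using comm[OF smooth(2), of 3 2] by (simp add: ax dfold Bz)
  qed
  have s3: "d 1 u p + c * (d 2 v p - p $ 1 * d 3 v p) = 0" for p
  proof -
    have "((\<lambda>p. d 1 B p + c * (d 2 A p - p $ 1 * d 3 A p)) has_derivative
       (\<lambda>w. dir_deriv w (d 1 B) p + c * (dir_deriv w (d 2 A) p
         - (p $ 1 * dir_deriv w (d 3 A) p + w $ 1 * d 3 A p)))) (at p)"
      by (intro has_derivative_add has_derivative_diff has_derivative_mult has_derivative_mult_right
          D Dx sm smooth)
    from has_derivative_zeroD[OF this e23, of "axis 3 1"] show ?thesis
      using comm[OF smooth(2), of 3 1] comm[OF smooth(1), of 3 2] by (simp add: ax dfold Az Bz)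
  qed
  have s4: "a * v p + b * d 3 u p = 0" for p
  proof -
    have "((\<lambda>p. a * (A p + d 2 C p - p $ 1 * d 3 C p) + b * d 3 B p) has_derivative
       (\<lambda>w. a * (dir_deriv w A p + dir_deriv w (d 2 C) p
         - (p $ 1 * dir_deriv w (d 3 C) p + w $ 1 * d 3 C p)) + b * dir_deriv w (d 3 B) p)) (at p)"
      by (intro has_derivative_add has_derivative_diff has_derivative_mult has_derivative_mult_right
          D Dx sm smooth)
    from has_derivative_zeroD[OF this e12, of "axis 3 1"]
    have "a * (v p + (d 2 (d 3 C) p - p $ 1 * d 3 (d 3 C) p)) + b * d 3 u p = 0"
      using comm[OF smooth(3), of 3 2] by (simp add: ax dfold Bz v_def algebra_simps)
    \<comment> \<open>The operator \<open>d 2 - x * d 3\<close> annihilates the coefficient x in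
      \<open>Cz\<close>, so it only acts on \<open>u\<close>, where \<open>s2\<close>
      applies.\<close>
    moreover have "d 2 (d 3 C) p - p $ 1 * d 3 (d 3 C) p = 0"
      using s2[of p] by (simp add: Czi ax)
    ultimately show ?thesis by simp
  qed
  have s5: "- (a * u p) + b * c * d 3 v p = 0" for p
  proof -
    have "((\<lambda>p. a * (p $ 1 * d 1 B p + d 1 C p) + b * c * d 3 A p) has_derivative
       (\<lambda>w. a * ((p $ 1 * dir_deriv w (d 1 B) p + w $ 1 * d 1 B p) + dir_deriv w (d 1 C) p)
         + b * c * dir_deriv w (d 3 A) p)) (at p)"
      by (intro has_derivative_add has_derivative_diff has_derivative_mult has_derivative_mult_right
          D Dx sm smooth)
    from has_derivative_zeroD[OF this e13, of "axis 3 1"]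
    have "a * (p $ 1 * d 1 u p + d 1 (d 3 C) p) + b * c * d 3 v p = 0"
      using comm[OF smooth(3), of 3 1] comm[OF smooth(2), of 3 1]
      by (simp add: ax dfold Bz Az)
    \<comment> \<open>The two terms x \<open>d 1 u\<close> cancel; what survives is
      \<open>- u\<close>, produced by differentiating the coefficient x in
      \<open>Cz\<close>.\<close>
    then show ?thesis by (simp add: Czi ax)
  qed
  have uzx: "d 1 (d 3 u) p = 0" for p
  proof -
    have "((\<lambda>p. a * v p + b * d 3 u p) has_derivative
       (\<lambda>w. a * dir_deriv w v p + b * dir_deriv w (d 3 u) p)) (at p)"
      by (intro has_derivative_add has_derivative_mult_right D sm su sv)
    from has_derivative_zeroD[OF this s4, of "axis 1 1"] show ?thesis
      using s1[of p] nz by (simp add: dfold)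
  qed
  have ux: "d 1 u p = 0" for p
  proof -
    have "((\<lambda>p. - (a * u p) + b * c * d 3 v p) has_derivative
       (\<lambda>w. - (a * dir_deriv w u p) + b * c * dir_deriv w (d 3 v) p)) (at p)"
      by (intro has_derivative_add has_derivative_minus has_derivative_mult_right D sm su sv)
    from has_derivative_zeroD[OF this s5, of "axis 1 1"]
    have "- (a * d 1 u p) + b * c * d 1 (d 3 v) p = 0"
      by (simp add: dfold)
    moreover have "d 1 (d 3 v) p = 0"
      using dir_deriv_zero[of "d 1 v", OF s1, of "axis 3 1"] comm[OF sv, of 3 1] by (simp add: d_def)
    ultimately show ?thesis
      using nz by simp
  qed
  \<comment> \<open>In the x-derivative of \<open>s2\<close> the coefficient x releases an isolated
    \<open>d 3 u\<close>: up to sign, the commutator of the two frame fields applied to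
    \<open>u\<close>.\<close>
  have uz: "d 3 u p = 0" for p
  proof -
    have "((\<lambda>p. d 2 u p - p $ 1 * d 3 u p) has_derivative
       (\<lambda>w. dir_deriv w (d 2 u) p - (p $ 1 * dir_deriv w (d 3 u) p + w $ 1 * d 3 u p))) (at p)"
      by (intro has_derivative_diff has_derivative_mult D Dx sm su)
    from has_derivative_zeroD[OF this s2, of "axis 1 1"]
    have "d 1 (d 2 u) p - (p $ 1 * d 1 (d 3 u) p + d 3 u p) = 0"
      by (simp add: ax dfold)
    moreover have "d 1 (d 2 u) p = 0"
      using dir_deriv_zero[of "d 1 u", OF ux, of "axis 2 1"] comm[OF su, of 1 2] by (simp add: d_def)
    ultimately show ?thesis by (simp add: uzx)
  qed
  \<comment> \<open>With \<open>d 3 u = 0\<close>, equation \<open>s4\<close> reduces to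
    \<open>a * v = 0\<close>; then \<open>d 3 v = 0\<close>, and \<open>s5\<close> reduces to
    \<open>a * u = 0\<close>.\<close>
  have v0: "v p = 0" for p
    using s4[of p] nz by (simp add: uz)
  have "d 3 v p = 0"
    unfolding d_def by (rule dir_deriv_zero[of v, OF v0])
  with s5[of p] have "u p = 0" using nz by simp
  with v0[of p] show "d 3 A p = 0" "d 3 B p = 0" by (simp_all add: u_def v_def)
qed

section \<open>Curvature of the Heisenberg metric\<close>

text \<open>\<open>M\<close> holds the coordinates of \<open>e\<close> with respect to
  \<open>f\<close>. Orthonormality of \<open>e\<close> says that \<open>M ** transpose M\<close> is
  the identity; since \<open>M\<close> is square, so is \<open>transpose M ** M\<close>, and this
  collapses the double sum for the trace. The hypothesis on \<open>f\<close> is the expansion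
  formula of an orthonormal basis, the form in which it is applied.\<close>

lemma trace_orthonormal_basis:
  fixes g B :: "real ^ 'n \<Rightarrow> real ^ 'n \<Rightarrow> real" and e f :: "'n \<Rightarrow> real ^ 'n"
  assumes g: "bilinear g" and B: "bilinear B"
    and e: "\<And>i j. g (e i) (e j) = (if i = j then 1 else 0)"
    and f: "\<And>u. u = (\<Sum>i\<in>UNIV. g u (f i) *\<^sub>R f i)"
  shows "(\<Sum>k\<in>UNIV. B (e k) (e k)) = (\<Sum>k\<in>UNIV. B (f k) (f k))"
proof -
  define M :: "real ^ 'n ^ 'n" where "M = (\<chi> k i. g (e k) (f i))"
  have "(\<Sum>i\<in>UNIV. M $ k $ i * M $ l $ i) = g (e k) (e l)" for k l
  proof -
    have "g (e k) (e l) = g (e k) (\<Sum>i\<in>UNIV. g (e l) (f i) *\<^sub>R f i)"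
      using f[of "e l"] by simp
    also have "\<dots> = (\<Sum>i\<in>UNIV. M $ k $ i * M $ l $ i)"
      using g unfolding bilinear_def
      by (simp add: linear_sum linear_cmul M_def mult.commute)
    finally show ?thesis ..
  qed
  then have "M ** transpose M = mat 1"
    by (simp add: vec_eq_iff matrix_matrix_mult_def transpose_def mat_def e)
  then have "transpose M ** M = mat 1"
    by (simp add: matrix_left_right_inverse)
  then have M: "(\<Sum>k\<in>UNIV. M $ k $ i * M $ k $ j) = (if i = j then 1 else 0)" for i j
    by (simp add: vec_eq_iff matrix_matrix_mult_def transpose_def mat_def)
  have "B (e k) (e k) = (\<Sum>i\<in>UNIV. \<Sum>j\<in>UNIV. M $ k $ i * M $ k $ j * B (f i) (f j))" for k
  proof -
    have "B (e k) (e k) = B (\<Sum>i\<in>UNIV. M $ k $ i *\<^sub>R f i) (\<Sum>j\<in>UNIV. M $ k $ j *\<^sub>R f j)"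
      using f[of "e k"] by (simp add: M_def)
    then show ?thesis
      by (simp add: bilinear_sum[OF B] sum.cartesian_product bilinear_lmul[OF B]
          bilinear_rmul[OF B] mult_ac)
  qed
  then have "(\<Sum>k\<in>UNIV. B (e k) (e k)) =
      (\<Sum>k\<in>UNIV. \<Sum>i\<in>UNIV. \<Sum>j\<in>UNIV. M $ k $ i * M $ k $ j * B (f i) (f j))" by simp
  also have "\<dots> = (\<Sum>i\<in>UNIV. \<Sum>k\<in>UNIV. \<Sum>j\<in>UNIV. M $ k $ i * M $ k $ j * B (f i) (f j))"
    by (rule sum.swap)
  also have "\<dots> = (\<Sum>i\<in>UNIV. \<Sum>j\<in>UNIV. \<Sum>k\<in>UNIV. M $ k $ i * M $ k $ j * B (f i) (f j))"
    by (intro sum.cong refl sum.swap)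
  also have "\<dots> = (\<Sum>i\<in>UNIV. \<Sum>j\<in>UNIV. if i = j then B (f i) (f j) else 0)"
    by (intro sum.cong refl) (simp add: sum_distrib_right[symmetric] M)
  finally show ?thesis by simp
qed

text \<open>\<open>onb\<close> is an unspecified choice, so a trace over it is evaluated by passing
  to an explicit orthonormal frame. The factor \<open>lam\<^sup>2\<close> appears because the unit
  vector along x is \<open>lam *\<^sub>R axis 1 1\<close>.\<close>

lemma heis_metric_trace:
  assumes lam: "lam > 0" and B: "bilinear B"
  shows "(\<Sum>k\<in>UNIV. heis_metric lam p (onb (heis_metric lam) p k) (onb (heis_metric lam) p k) *
      B (onb (heis_metric lam) p k) (onb (heis_metric lam) p k)) =
    lam\<^sup>2 * B (axis 1 1) (axis 1 1)
      + B (axis 2 1 - p $ 1 *\<^sub>R axis 3 1) (axis 2 1 - p $ 1 *\<^sub>R axis 3 1)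
      + B (axis 3 1) (axis 3 1)"
proof -
  define e where "e = onb (heis_metric lam) p"
  define f where "f = (\<lambda>k::3. if k = 1 then axis 3 1 else if k = 2 then axis 2 1 - p $ 1 *\<^sub>R axis 3 1
    else lam *\<^sub>R axis 1 1 :: real ^ 3)"
  have on: "orthonormal_at (heis_metric lam) p e"
    unfolding e_def using lam by (rule orthonormal_at_onb_heis_metric)
  \<comment> \<open>\<open>orthonormal_at\<close> fixes the squared lengths only up to sign;
    positive definiteness makes them 1.\<close>
  then have "e i \<noteq> 0" for i
    using bilinear_lzero[OF heis_metric_bilinear, of lam p 0]
    by (metis abs_zero orthonormal_at_def zero_neq_one)
  then have "heis_metric lam p (e i) (e i) > 0" for i
    by (rule heis_metric_pos_def[OF lam])
  with on have e: "heis_metric lam p (e i) (e j) = (if i = j then 1 else 0)" for i j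
    by (auto simp: orthonormal_at_def) (metis abs_of_pos)
  have f: "u = (\<Sum>i\<in>UNIV. heis_metric lam p u (f i) *\<^sub>R f i)" for u
    using lam by (simp add: f_def sum_3 vec_eq_iff forall_3 heis_metric_def axis_def power2_eq_square)
  have "(\<Sum>k\<in>UNIV. B (e k) (e k)) = (\<Sum>k\<in>UNIV. B (f k) (f k))"
    by (rule trace_orthonormal_basis[OF heis_metric_bilinear B e f])
  then show ?thesis
    unfolding e_def[symmetric]
    by (simp add: e f_def sum_3 bilinear_lmul[OF B] bilinear_rmul[OF B] power2_eq_square)
qed

section \<open>The Levi-Civita connection in coordinates\<close>

text \<open>The Christoffel symbols at \<open>p\<close>, contracted with the tangent vectors
  \<open>u\<close> and \<open>v\<close>.\<close>

definition heis_gamma :: "real \<Rightarrow> real ^ 3 \<Rightarrow> real ^ 3 \<Rightarrow> real ^ 3 \<Rightarrow> real ^ 3" where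
  "heis_gamma lam p u v = vector
    [- lam\<^sup>2 * (p $ 1 * u $ 2 * v $ 2 + (u $ 2 * v $ 3 + u $ 3 * v $ 2) / 2),
     p $ 1 / 2 * (u $ 1 * v $ 2 + u $ 2 * v $ 1) + (u $ 1 * v $ 3 + u $ 3 * v $ 1) / 2,
     (1 - (p $ 1)\<^sup>2) / 2 * (u $ 1 * v $ 2 + u $ 2 * v $ 1) - p $ 1 / 2 * (u $ 1 * v $ 3 + u $ 3 * v $ 1)]"

lemma partial_gram_heis_metric:
  "partial i (\<lambda>q. gram (heis_metric lam) q $ j $ l) p =
     axis i 1 $ 1 * (axis j 1 $ 2 * (p $ 1 * axis l 1 $ 2 + axis l 1 $ 3)
       + (p $ 1 * axis j 1 $ 2 + axis j 1 $ 3) * axis l 1 $ 2)"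
proof -
  let ?u = "axis j 1 :: real ^ 3" and ?v = "axis l 1 :: real ^ 3"
  have "((\<lambda>q. heis_metric lam q ?u ?v) has_derivative
      (\<lambda>w. w $ 1 * (?u $ 2 * (p $ 1 * ?v $ 2 + ?v $ 3) + (p $ 1 * ?u $ 2 + ?u $ 3) * ?v $ 2))) (at p)"
    unfolding heis_metric_def
    by (auto intro!: derivative_eq_intros has_derivative_nth_1 simp: algebra_simps)
  from frechet_derivative_at[OF this, symmetric] show ?thesis
    by (simp add: partial_def gram_def)
qed

text \<open>No matrix is inverted: both sides solve the linear system that
  \<open>christoffel_lower\<close> provides, with the Gram matrix as coefficients, and elimination
  shows that they agree.\<close>

lemma christoffel_heis_metric:
  assumes "lam > 0"
  shows "christoffel (heis_metric lam) k i j p = heis_gamma lam p (axis i 1) (axis j 1) $ k"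
proof -
  let ?C = "\<lambda>k. christoffel (heis_metric lam) k i j p"
  note low = christoffel_lower[OF heis_metric_gram_invertible[OF assms], where i = i and j = j and p = p,
      unfolded partial_gram_heis_metric]
  have G: "gram (heis_metric lam) p $ k $ l = (if k = 1 \<and> l = 1 then 1 / lam\<^sup>2 else
     if k = 2 \<and> l = 2 then 1 + (p $ 1)\<^sup>2 else if k = 3 \<and> l = 3 then 1 else
     if k = 1 \<or> l = 1 then 0 else p $ 1)" for k l
    using exhaust_3[of k] exhaust_3[of l]
    by (auto simp: gram_def heis_metric_def axis_def power2_eq_square)
  let ?g = "heis_gamma lam p (axis i 1) (axis j 1)"
  have ax: "axis (1::3) (1::real) $ (1::3) = 1" "axis (1::3) (1::real) $ (2::3) = 0"
    "axis (1::3) (1::real) $ (3::3) = 0" "axis (2::3) (1::real) $ (1::3) = 0"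
    "axis (2::3) (1::real) $ (2::3) = 1" "axis (2::3) (1::real) $ (3::3) = 0"
    "axis (3::3) (1::real) $ (1::3) = 0" "axis (3::3) (1::real) $ (2::3) = 0"
    "axis (3::3) (1::real) $ (3::3) = 1"
    by (simp_all add: axis_def)
  have 1: "?C 1 = ?g $ 1"
    using low[of 1] assms by (simp add: sum_3 G heis_gamma_def ax field_simps)
  have 2: "(1 + (p $ 1)\<^sup>2) * ?C 2 + p $ 1 * ?C 3 = (1 + (p $ 1)\<^sup>2) * ?g $ 2 + p $ 1 * ?g $ 3"
    using low[of 2] by (simp add: sum_3 G heis_gamma_def ax) (simp add: power2_eq_square field_simps)
  have 3: "p $ 1 * ?C 2 + ?C 3 = p $ 1 * ?g $ 2 + ?g $ 3"
    using low[of 3] by (simp add: sum_3 G heis_gamma_def ax) (simp add: power2_eq_square field_simps)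
  \<comment> \<open>Subtracting \<open>p $ 1\<close> times row 3 of the system from row 2 isolates
    the second unknown; row 3 then determines the third.\<close>
  have "?C 2 = ?g $ 2"
  proof -
    have "(1 + (p $ 1)\<^sup>2) * a + p $ 1 * b - p $ 1 * (p $ 1 * a + b) = a" for a b
      by (simp add: power2_eq_square algebra_simps)
    from this[of "?C 2" "?C 3"] this[of "?g $ 2" "?g $ 3"] 2 3 show ?thesis by metis
  qed
  with 1 3 assms show ?thesis
    using exhaust_3[of k] by auto
qed

lemma levi_civita_heis_metric:
  assumes "lam > 0"
  shows "levi_civita (heis_metric lam) X Y p = deriv_along X Y p + heis_gamma lam p (X p) (Y p)"
  unfolding levi_civita_def christoffel_heis_metric[OF assms]
  by (simp add: vec_eq_iff forall_3 sum_3 heis_gamma_def axis_def algebra_simps)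

section \<open>The Riemann tensor\<close>

text \<open>The derivative of \<open>heis_gamma lam p v w\<close> in the base point \<open>p\<close>
  along \<open>u\<close>. The factor \<open>u $ 1\<close> reflects that the Christoffel symbols
  depend on x alone.\<close>

definition heis_gamma_deriv :: "real \<Rightarrow> real ^ 3 \<Rightarrow> real ^ 3 \<Rightarrow> real ^ 3 \<Rightarrow> real ^ 3 \<Rightarrow> real ^ 3" where
  "heis_gamma_deriv lam p u v w = u $ 1 *\<^sub>R vector
    [- lam\<^sup>2 * (v $ 2 * w $ 2),
     (v $ 1 * w $ 2 + v $ 2 * w $ 1) / 2,
     - p $ 1 * (v $ 1 * w $ 2 + v $ 2 * w $ 1) - (v $ 1 * w $ 3 + v $ 3 * w $ 1) / 2]"

text \<open>The classical coordinate formula for R(u,v)w: first derivatives of the Christoffel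
  symbols plus their quadratic terms.\<close>

definition heis_riemann :: "real \<Rightarrow> real ^ 3 \<Rightarrow> real ^ 3 \<Rightarrow> real ^ 3 \<Rightarrow> real ^ 3 \<Rightarrow> real ^ 3" where
  "heis_riemann lam p u v w =
     heis_gamma_deriv lam p u v w - heis_gamma_deriv lam p v u w
       + heis_gamma lam p u (heis_gamma lam p v w) - heis_gamma lam p v (heis_gamma lam p u w)"

lemma has_derivative_heis_gamma:
  "((\<lambda>q. heis_gamma lam q v w) has_derivative (\<lambda>u. heis_gamma_deriv lam p u v w)) (at p)"
proof -
  let ?x = "\<lambda>q :: real ^ 3. q $ 1"
  \<comment> \<open>In x, the first two components are affine and the third is quadratic;
    \<open>affine\<close> and \<open>square\<close> cover the two shapes.\<close>
  have affine: "((\<lambda>q. ?x q * c + c') has_derivative (\<lambda>u. u $ 1 * c)) (at p)" for c c'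
    by (auto intro!: derivative_eq_intros has_derivative_nth_1)
  have square: "((\<lambda>q. (1 - (?x q)\<^sup>2) * c - ?x q * c') has_derivative
      (\<lambda>u. u $ 1 * (- 2 * p $ 1 * c - c'))) (at p)" for c c'
    by (auto intro!: derivative_eq_intros has_derivative_nth_1 simp: algebra_simps)
  have eq1: "heis_gamma lam q v w $ 1 = ?x q * (- lam\<^sup>2 * (v $ 2 * w $ 2)) + - lam\<^sup>2 * ((v $ 2 * w $ 3 + v $ 3 * w $ 2) / 2)" for q
    by (simp add: heis_gamma_def algebra_simps add_divide_distrib)
  have eq1': "heis_gamma_deriv lam p u v w $ 1 = u $ 1 * (- lam\<^sup>2 * (v $ 2 * w $ 2))" for u
    by (simp add: heis_gamma_deriv_def algebra_simps)
  have d1: "((\<lambda>q. heis_gamma lam q v w $ 1) has_derivative (\<lambda>u. heis_gamma_deriv lam p u v w $ 1)) (at p)"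
    unfolding eq1 eq1' by (rule affine)
  have eq2: "heis_gamma lam q v w $ 2 = ?x q * ((v $ 1 * w $ 2 + v $ 2 * w $ 1) / 2) + ((v $ 1 * w $ 3 + v $ 3 * w $ 1) / 2)" for q
    by (simp add: heis_gamma_def algebra_simps add_divide_distrib)
  have eq2': "heis_gamma_deriv lam p u v w $ 2 = u $ 1 * ((v $ 1 * w $ 2 + v $ 2 * w $ 1) / 2)" for u
    by (simp add: heis_gamma_deriv_def algebra_simps)
  have d2: "((\<lambda>q. heis_gamma lam q v w $ 2) has_derivative (\<lambda>u. heis_gamma_deriv lam p u v w $ 2)) (at p)"
    unfolding eq2 eq2' by (rule affine)
  have eq3: "heis_gamma lam q v w $ 3 = (1 - (?x q)\<^sup>2) * ((v $ 1 * w $ 2 + v $ 2 * w $ 1) / 2) - ?x q * ((v $ 1 * w $ 3 + v $ 3 * w $ 1) / 2)" for q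
    by (simp add: heis_gamma_def algebra_simps add_divide_distrib)
  have eq3': "heis_gamma_deriv lam p u v w $ 3 = u $ 1 * (- 2 * p $ 1 * ((v $ 1 * w $ 2 + v $ 2 * w $ 1) / 2) - ((v $ 1 * w $ 3 + v $ 3 * w $ 1) / 2))" for u
    by (simp add: heis_gamma_deriv_def algebra_simps)
  have d3: "((\<lambda>q. heis_gamma lam q v w $ 3) has_derivative (\<lambda>u. heis_gamma_deriv lam p u v w $ 3)) (at p)"
    unfolding eq3 eq3' by (rule square)
  have "((\<lambda>q. heis_gamma lam q v w $ i) has_derivative (\<lambda>u. heis_gamma_deriv lam p u v w $ i)) (at p)" for i
    using exhaust_3[of i] d1 d2 d3 by metis
  then show ?thesis
    by (subst has_derivative_componentwise_within) (auto simp: Basis_vec_def inner_axis)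
qed

lemma deriv_along_const: "deriv_along X (\<lambda>_. c) p = 0"
  by (simp add: deriv_along_def)

text \<open>Constant fields commute, which removes the bracket term, and the covariant derivative of
  one along another is just \<open>heis_gamma\<close>, so the outer derivative differentiates only
  the Christoffel symbols.\<close>

lemma curvature_heis_metric:
  assumes "lam > 0"
  shows "curvature (heis_metric lam) (\<lambda>_. u) (\<lambda>_. v) (\<lambda>_. w) p = heis_riemann lam p u v w"
proof -
  have "levi_civita (heis_metric lam) (\<lambda>_. v) (\<lambda>_. w) = (\<lambda>q. heis_gamma lam q v w)" for v w
    by (simp add: fun_eq_iff levi_civita_heis_metric[OF assms] deriv_along_const)
  moreover have "deriv_along (\<lambda>_. u) (\<lambda>q. heis_gamma lam q v w) p = heis_gamma_deriv lam p u v w" for u v w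
    unfolding deriv_along_def by (simp add: frechet_derivative_at[OF has_derivative_heis_gamma, symmetric])
  moreover have "lie_bracket (\<lambda>_. u) (\<lambda>_. v) = (\<lambda>_. 0)"
    by (simp add: fun_eq_iff lie_bracket_def deriv_along_const)
  moreover have "heis_gamma lam p 0 w = 0"
    by (simp add: heis_gamma_def vec_eq_iff forall_3)
  ultimately show ?thesis
    by (simp add: curvature_def levi_civita_heis_metric[OF assms] deriv_along_const heis_riemann_def)
qed

section \<open>Ricci tensor, scalar curvature and energy-momentum tensor\<close>

text \<open>Metric, Ricci tensor and energy-momentum tensor all belong to this family, so one Lie
  derivative computation serves all three.\<close>

definition heis_form :: "real \<Rightarrow> real \<Rightarrow> real \<Rightarrow> tensor02" where
  "heis_form lam a b p u v =
     a * ((p $ 1 * u $ 2 + u $ 3) * (p $ 1 * v $ 2 + v $ 3))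
       + b * (u $ 1 * v $ 1 / lam\<^sup>2 + u $ 2 * v $ 2)"

lemma heis_metric_eq_form: "heis_metric lam = heis_form lam 1 1"
  by (simp add: fun_eq_iff heis_metric_def heis_form_def)

text \<open>Makes the contraction that defines the Ricci tensor accessible to
  \<open>heis_metric_trace\<close>.\<close>

lemma bilinear_heis_riemann:
  "bilinear (\<lambda>s t. heis_metric lam p (heis_riemann lam p s u v) t)"
proof -
  have add: "heis_riemann lam p (s + t) u v = heis_riemann lam p s u v + heis_riemann lam p t u v" for s t
    by (simp add: heis_riemann_def heis_gamma_def heis_gamma_deriv_def vec_eq_iff forall_3
        algebra_simps add_divide_distrib diff_divide_distrib)
  have scale: "heis_riemann lam p (c *\<^sub>R s) u v = c *\<^sub>R heis_riemann lam p s u v" for c s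
    by (simp add: heis_riemann_def heis_gamma_def heis_gamma_deriv_def vec_eq_iff forall_3
        algebra_simps add_divide_distrib diff_divide_distrib)
  show ?thesis
    using heis_metric_bilinear[of lam p] unfolding bilinear_def
    by (auto intro!: linearI simp: add scale linear_iff)
qed

lemma ricci_heis_metric:
  assumes "lam > 0"
  shows "ricci (heis_metric lam) = heis_form lam (lam\<^sup>2 / 2) (- lam\<^sup>2 / 2)"
proof (intro ext)
  fix p u v
  have "ricci (heis_metric lam) p u v =
      lam\<^sup>2 * heis_metric lam p (heis_riemann lam p (axis 1 1) u v) (axis 1 1)
      + heis_metric lam p (heis_riemann lam p (axis 2 1 - p $ 1 *\<^sub>R axis 3 1) u v)
          (axis 2 1 - p $ 1 *\<^sub>R axis 3 1)
      + heis_metric lam p (heis_riemann lam p (axis 3 1) u v) (axis 3 1)"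
    unfolding ricci_def curvature_heis_metric[OF assms]
    using heis_metric_trace[OF assms bilinear_heis_riemann] .
  also have "\<dots> = heis_form lam (lam\<^sup>2 / 2) (- lam\<^sup>2 / 2) p u v"
    using assms
    by (simp add: heis_metric_def heis_riemann_def heis_gamma_def heis_gamma_deriv_def heis_form_def axis_def
        field_simps power2_eq_square)
  finally show "ricci (heis_metric lam) p u v = heis_form lam (lam\<^sup>2 / 2) (- lam\<^sup>2 / 2) p u v" .
qed

lemma bilinear_heis_form: "bilinear (heis_form lam a b p)"
  unfolding bilinear_def
  by (auto intro!: linearI simp: heis_form_def algebra_simps add_divide_distrib)

text \<open>The trace of \<open>heis_form lam a b\<close> is \<open>a + 2 * b\<close>:
  \<open>a\<close> comes from the direction z and \<open>b\<close> from each of the other two frame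
  vectors.\<close>

lemma scalar_curvature_heis_metric:
  assumes "lam > 0"
  shows "scalar_curvature (heis_metric lam) p = - lam\<^sup>2 / 2"
  using assms
  by (simp add: scalar_curvature_def ricci_heis_metric heis_metric_trace bilinear_heis_form)
    (simp add: heis_form_def axis_def)

text \<open>Subtracting half the scalar curvature times the metric adds
  \<open>lam\<^sup>2 / 4\<close> to both weights, and neither becomes zero.\<close>

lemma energy_momentum_heis_metric:
  assumes "lam > 0"
  shows "energy_momentum (heis_metric lam) = heis_form lam (3 * lam\<^sup>2 / 4) (- lam\<^sup>2 / 4)"
  unfolding energy_momentum_def[abs_def] ricci_heis_metric[OF assms] scalar_curvature_heis_metric[OF assms]
  by (simp add: heis_metric_eq_form heis_form_def fun_eq_iff algebra_simps add_divide_distrib)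

section \<open>Collineations of the invariant forms\<close>

text \<open>The first summand pairs the Lie derivative of the contact form \<open>x dy + dz\<close> with the form itself.\<close>

definition heis_lie_form :: "real \<Rightarrow> real \<Rightarrow> real \<Rightarrow> vfield \<Rightarrow> tensor02" where
  "heis_lie_form lam a b X p u v =
     (let \<alpha> = (\<lambda>w. X p $ 1 * w $ 2 + p $ 1 * dir_deriv w X p $ 2 + dir_deriv w X p $ 3);
          \<theta> = (\<lambda>w. p $ 1 * w $ 2 + w $ 3)
      in a * (\<alpha> u * \<theta> v + \<theta> u * \<alpha> v)
       + b * ((dir_deriv u X p $ 1 * v $ 1 + u $ 1 * dir_deriv v X p $ 1) / lam\<^sup>2
           + (dir_deriv u X p $ 2 * v $ 2 + u $ 2 * dir_deriv v X p $ 2)))"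

text \<open>The derivatives of \<open>Y\<close> and \<open>Z\<close> from the product rule cancel
  those in the brackets. Only derivatives of \<open>X\<close> and of the coefficient x remain, so
  the result depends on \<open>Y\<close> and \<open>Z\<close> through their values at
  \<open>p\<close>.\<close>

lemma lie_derivative_heis_form:
  assumes "Y differentiable (at p)" "Z differentiable (at p)"
  shows "lie_derivative X (heis_form lam a b) Y Z p = heis_lie_form lam a b X p (Y p) (Z p)"
proof -
  have D: "((\<lambda>q. W q $ i) has_derivative (\<lambda>w. dir_deriv w W p $ i)) (at p)"
    if "W differentiable (at p)" for W :: vfield and i
    using bounded_linear.has_derivative[OF bounded_linear_vec_nth has_derivative_dir_deriv[OF that]] .
  note DY = D[OF assms(1)] and DZ = D[OF assms(2)]
  let ?D = "\<lambda>w i. dir_deriv w Y p $ i" and ?E = "\<lambda>w i. dir_deriv w Z p $ i"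
  have "((\<lambda>q. heis_form lam a b q (Y q) (Z q)) has_derivative
     (\<lambda>w. a * ((p $ 1 * Y p $ 2 + Y p $ 3) * ((p $ 1 * ?E w 2 + w $ 1 * Z p $ 2) + ?E w 3)
            + ((p $ 1 * ?D w 2 + w $ 1 * Y p $ 2) + ?D w 3) * (p $ 1 * Z p $ 2 + Z p $ 3))
        + b * ((Y p $ 1 * ?E w 1 + ?D w 1 * Z p $ 1) / lam\<^sup>2
            + (Y p $ 2 * ?E w 2 + ?D w 2 * Z p $ 2)))) (at p)"
    unfolding heis_form_def
    by (intro has_derivative_add has_derivative_mult_right has_derivative_mult
        bounded_linear.has_derivative[OF bounded_linear_divide] DY DZ has_derivative_nth_1)
  from dir_deriv_eqI[OF this] show ?thesis
    by (simp add: lie_derivative_def lie_bracket_def deriv_along_def dir_deriv_def[symmetric]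
        heis_form_def heis_lie_form_def Let_def)
      (simp add: algebra_simps add_divide_distrib diff_divide_distrib)
qed

text \<open>By this pointwise dependence, constant fields already test every pair of tangent
  vectors.\<close>

lemma lie_derivative_vanishes_heis_form:
  "lie_derivative_vanishes X (heis_form lam a b) \<longleftrightarrow> (\<forall>p u v. heis_lie_form lam a b X p u v = 0)"
proof
  assume L: "lie_derivative_vanishes X (heis_form lam a b)"
  show "\<forall>p u v. heis_lie_form lam a b X p u v = 0"
  proof (intro allI)
    fix p u v
    have "lie_derivative X (heis_form lam a b) (\<lambda>_. u) (\<lambda>_. v) p = 0"
      using L by (simp add: lie_derivative_vanishes_def smooth_const)
    then show "heis_lie_form lam a b X p u v = 0"
      by (simp add: lie_derivative_heis_form)
  qed
qed (simp add: lie_derivative_vanishes_def lie_derivative_heis_form smooth_imp_differentiable)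

text \<open>The target weights \<open>a'\<close> and \<open>b'\<close> are arbitrary, so the
  implication can be used in both directions between two pairs of nonzero weights.\<close>

lemma heis_form_invariant_weights:
  assumes X: "smooth X" and nz: "lam \<noteq> 0" "a \<noteq> 0" "b \<noteq> 0"
    and L: "lie_derivative_vanishes X (heis_form lam a b)"
  shows "lie_derivative_vanishes X (heis_form lam a' b')"
proof -
  let ?d = "\<lambda>i p. dir_deriv (axis i 1 :: real ^ 3) X p"
  have lin: "linear (\<lambda>w. dir_deriv w X p)" for p
    using smooth_has_derivative[OF X] has_derivative_linear by blast
  have ex: "dir_deriv w X p = w $ 1 *\<^sub>R ?d 1 p + w $ 2 *\<^sub>R ?d 2 p + w $ 3 *\<^sub>R ?d 3 p" for w p
  proof -
    have "w = (\<Sum>i\<in>UNIV. w $ i *\<^sub>R axis i 1)"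
      by (simp add: basis_expansion scalar_mult_eq_scaleR[symmetric])
    then have "dir_deriv w X p = (\<Sum>i\<in>UNIV. w $ i *\<^sub>R ?d i p)"
      using linear_sum[OF lin, of "\<lambda>i. w $ i *\<^sub>R axis i 1" UNIV p] linear_cmul[OF lin] by simp
    then show ?thesis by (simp add: sum_3)
  qed
  \<comment> \<open>The frame vector over the y-direction that lies in the kernel of theta = x dy +
    dz.\<close>
  let ?e = "\<lambda>p :: real ^ 3. axis 2 1 - p $ 1 *\<^sub>R axis 3 1 :: real ^ 3"
  have L0: "heis_lie_form lam a b X p u v = 0" for p u v
    using L by (simp add: lie_derivative_vanishes_heis_form)
  have ax: "axis i (1::real) $ (j::3) = (if i = j then 1 else 0)" for i j
    by (simp add: axis_def)
  note simps = heis_lie_form_def Let_def ax ex[of "?e _"] nz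
  \<comment> \<open>Theta is 1 on \<open>axis 3 1\<close> and 0 on \<open>?e p\<close> and
    \<open>axis 1 1\<close>. Hence \<open>e11\<close> carries the weight \<open>a\<close> alone,
    \<open>e22\<close>, \<open>e33\<close> and \<open>e23\<close> carry \<open>b\<close> alone, and
    these weights are cancelled; \<open>e12\<close> and \<open>e13\<close> mix both.\<close>
  have e11: "p $ 1 * ?d 3 p $ 2 + ?d 3 p $ 3 = 0" for p
    using L0[of p "axis 3 1" "axis 3 1"] by (simp add: simps)
  have e22: "?d 2 p $ 2 - p $ 1 * ?d 3 p $ 2 = 0" for p
    using L0[of p "?e p" "?e p"] by (simp add: simps)
  have e33: "?d 1 p $ 1 = 0" for p
    using L0[of p "axis 1 1" "axis 1 1"] by (simp add: simps)
  have e23: "?d 1 p $ 2 + 1 / lam\<^sup>2 * (?d 2 p $ 1 - p $ 1 * ?d 3 p $ 1) = 0" for p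
    using L0[of p "axis 1 1" "?e p"] by (simp add: simps add.commute)
  have e12': "a * (X p $ 1 + p $ 1 * (?d 2 p $ 2 - p $ 1 * ?d 3 p $ 2) + (?d 2 p $ 3 - p $ 1 * ?d 3 p $ 3))
      + b * ?d 3 p $ 2 = 0" for p
    using L0[of p "axis 3 1" "?e p"] by (simp add: simps)
  have e12: "a * (X p $ 1 + ?d 2 p $ 3 - p $ 1 * ?d 3 p $ 3) + b * ?d 3 p $ 2 = 0" for p
    using e12'[of p] by (simp add: e22 add_diff_eq)
  have e13: "a * (p $ 1 * ?d 1 p $ 2 + ?d 1 p $ 3) + b * (1 / lam\<^sup>2) * ?d 3 p $ 1 = 0" for p
    using L0[of p "axis 3 1" "axis 1 1"] by (simp add: simps)
  have nth: "dir_deriv w X p $ i = dir_deriv w (\<lambda>q. X q $ i) p" for w p i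
    using dir_deriv_nth[OF smooth_imp_differentiable[OF X]] by simp
  have "1 / lam\<^sup>2 \<noteq> 0" using nz by simp
  note pde = heisenberg_collineation_pde[OF smooth_nth[OF X] smooth_nth[OF X] smooth_nth[OF X] nz(2,3) this
      e11[unfolded nth] e22[unfolded nth] e33[unfolded nth] e23[unfolded nth] e12[unfolded nth] e13[unfolded nth]]
  \<comment> \<open>The first two come from the differential equations; the third then follows from
    \<open>e11\<close>.\<close>
  have z: "?d 3 p $ 1 = 0" "?d 3 p $ 2 = 0" "?d 3 p $ 3 = 0" for p
    using pde[of p] e11[of p] by (simp_all add: nth)
  have y2: "?d 2 p $ 2 = 0" for p
    using e22[of p] by (simp add: z)
  have y3: "?d 2 p $ 3 = - X p $ 1" for p
    using e12[of p] nz by (simp add: z)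
  have x3: "?d 1 p $ 3 = - (p $ 1 * ?d 1 p $ 2)" for p
    using e13[of p] nz by (simp add: z add_eq_0_iff)
  have x2: "?d 1 p $ 2 = - (?d 2 p $ 1 / lam\<^sup>2)" for p
    using e23[of p] by (simp add: z add_eq_0_iff)
  \<comment> \<open>The relations \<open>z\<close>, \<open>y2\<close>, \<open>y3\<close> and
    \<open>x3\<close> make the Lie derivative of theta vanish, which settles the \<open>a'\<close>
    part; \<open>e33\<close>, \<open>y2\<close>, \<open>z\<close> and \<open>x2\<close> cancel the
    \<open>b'\<close> part.\<close>
  have "heis_lie_form lam a' b' X p u v = 0" for p u v
    unfolding heis_lie_form_def Let_def ex[of u] ex[of v]
    by (simp add: z e33 y2 y3 x3 x2) (simp add: algebra_simps add_divide_distrib)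
  then show ?thesis
    by (simp add: lie_derivative_vanishes_heis_form)
qed

theorem mainTheorem11:
  fixes lam :: real
  assumes "lam > 0"
  shows "{X. matter_collineation (heis_metric lam) X} = {X. ricci_collineation (heis_metric lam) X}
    \<and> {X. ricci_collineation (heis_metric lam) X} = {X. killing_field (heis_metric lam) X}"
proof -
  \<comment> \<open>The metric has weights 1 and 1, so \<open>heis_form_invariant_weights\<close>
    applies from \<open>(a, b)\<close> to \<open>(1, 1)\<close> and back.\<close>
  have "lie_derivative_vanishes X (heis_form lam a b) \<longleftrightarrow> lie_derivative_vanishes X (heis_metric lam)"
    if "smooth X" "a \<noteq> 0" "b \<noteq> 0" for X a b
    unfolding heis_metric_eq_form
    using heis_form_invariant_weights[OF that(1)] that assms by (metis less_irrefl zero_neq_one)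
  then show ?thesis
    using assms
    by (auto simp: matter_collineation_def ricci_collineation_def killing_field_def
        energy_momentum_heis_metric ricci_heis_metric)
qed

end
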